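(* Let $(S,N)$ be a quadratic normalisation mod $e$ for a monoid $M$. If the weak domino rule is valid for $\overline{N}$, then $\overline{N}$ is a local factorability structure on $(M,S)$ (with $e$ in the role of $1$).
   Context: Notation. $S$ is a generating set of $M$ with a distinguished letter $e$ representing $1\in M$, and $S_+=S\setminus\{e\}$; $S$ is identified with its image in $M$ under evaluation, and $e$ is identified with $1$. $S^*$ is the free monoid over $S$; words are written $(s_1,\ldots,s_n)=s_1|\cdots|s_n$; $|w|$ is the length of $w$. For $F:A^2\to A^2$, $F_i$ applies $F$ to the entries at positions $i,i+1$ of a word over $A$ (from the left). Compositions are read with the rightmost map applied first. Normalisation. A normalisation is a pair $(A,N)$ with $N:A^*\to A^*$ length-preserving, identity on one-letter words, and $N(u|v|w)=N(u|N(v)|w)$ for all words $u,v,w$; $w$ is $N$-normal if $N(w)=w$; $\overline{N}:A^2\to A^2$ is the restriction of $N$ to length-two words. $(A,N)$ is quadratic if a word is $N$-normal iff all its length-two factors are, and for each word $w$ there is a finite sequence of positions $(i_1,\ldots,i_k)$ with $N(w)=\overline{N}_{i_k}\cdots\overline{N}_{i_1}(w)$. $e\in A$ is $N$-neutral if $N(w|e)=N(e|w)=N(w)|e$ for all $w$. $(S,N)$ is a normalisation mod $e$ for $M$ if $e\in S$ is $N$-neutral and $M$ is presented (via evaluation) by $\langle S\mid\{w=N(w):w\in S^*\}\cup\{e=1\}\rangle$. Weak domino rule. It is valid for $F=\overline{N}$ if for all $r_1,r_2,r_1',r_2',s_0,s_1,s_2\in S$ with $F(s_0|r_1)=r_1'|s_1$,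 $F(s_1|r_2)=r_2'|s_2$ and none of $r_1',r_2',s_2$ equal to $e$: if $r_1|r_2$, $r_1'|s_1$, $r_2'|s_2$ are fixed points of $F$, then so is $r_1'|r_2'$. Local factorability. For $\varphi:S^2\to S^2$ and $w\in S^*$ put $T_\varphi(w)=\varphi_{|w|-1}\cdots\varphi_1(w)$ ($T_\varphi(w)=w$ if $|w|=1$). $N_\varphi:S^*\to S^*$ is defined recursively: $N_\varphi$ of the empty word is empty; $N_\varphi$ of a word containing $1$ equals $N_\varphi$ of the word with $1$ removed; for $s_1,\ldots,s_n\in S_+$, putting $v=T_\varphi(s_1|N_\varphi(s_2,\ldots,s_n))$, $N_\varphi(s_1,\ldots,s_n)=v$ if $v$ contains no $1$, and $=N_\varphi(v)$ otherwise. A local factorability structure on $(M,S)$ is a map $\varphi:S^2\to S^2$ such that: (1) $M$ admits the presentation $\langle S_+\mid\{(s,t)=\varphi(s,t):s,t\in S_+\}\rangle$ (letters $1$ occurring in $\varphi(s,t)$ being read as the empty word); (2) $\varphi$ is idempotent; (3) $\varphi(1,s)=(s,1)$ for every $s\in S_+$; (4) for every $(r,s,t)\in S_+^3$, either $\varphi_1\varphi_2\varphi_1\varphi_2(r,s,t)=\varphi_2\varphi_1\varphi_2(r,s,t)$ or $\varphi_2\varphi_1\varphi_2(r,s,t)$ contains $1$; (5) $N_\varphi(r,s,t)=N_\varphi(\varphi_1(r,s,t))$ for every $(r,s,t)\in S^3$. *)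

theory Defs
  imports "HOL-Algebra.Group"
begin

text \<open>
  Words over an alphabet \<open>A\<close> are elements of \<open>lists A\<close>. An alphabet \<open>A\<close> generating a monoid
  \<open>M\<close> comes with an evaluation \<open>ev\<close> of letters in \<open>M\<close>; the case of a generating subset is
  \<open>ev = (\<lambda>x. x)\<close>. Conditions on maps are imposed only on letters and words over the alphabet.
\<close>

definition eval_word :: "('m, 'b) monoid_scheme \<Rightarrow> ('a \<Rightarrow> 'm) \<Rightarrow> 'a list \<Rightarrow> 'm" where
  "eval_word M ev w = foldr (mult M) (map ev w) (one M)"

inductive word_cong :: "'a set \<Rightarrow> ('a list \<times> 'a list) set \<Rightarrow> 'a list \<Rightarrow> 'a list \<Rightarrow> bool"
  for A R where
  rel: "(l, r) \<in> R \<Longrightarrow> u \<in> lists A \<Longrightarrow> v \<in> lists A \<Longrightarrow> word_cong A R (u @ l @ v) (u @ r @ v)"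
| refl: "u \<in> lists A \<Longrightarrow> word_cong A R u u"
| sym: "word_cong A R u v \<Longrightarrow> word_cong A R v u"
| trans: "word_cong A R u v \<Longrightarrow> word_cong A R v w \<Longrightarrow> word_cong A R u w"

text \<open>The evaluation induces an isomorphism from the quotient of the free monoid over \<open>A\<close> by the
  congruence generated by \<open>R\<close> onto \<open>M\<close>.\<close>

definition presented_by ::
  "('m, 'b) monoid_scheme \<Rightarrow> ('a \<Rightarrow> 'm) \<Rightarrow> 'a set \<Rightarrow> ('a list \<times> 'a list) set \<Rightarrow> bool" where
  "presented_by M ev A R \<longleftrightarrow>
     R \<subseteq> lists A \<times> lists A \<and>
     ev ` A \<subseteq> carrier M \<and>
     eval_word M ev ` lists A = carrier M \<and>
     (\<forall>u\<in>lists A. \<forall>v\<in>lists A. eval_word M ev u = eval_word M ev v \<longleftrightarrow> word_cong A R u v)"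

text \<open>\<open>apply_at F i\<close> is $F_i$, with positions counted from 1; it is meaningful for
  \<open>1 \<le> i < length w\<close> only.\<close>

definition apply_at :: "('a \<times> 'a \<Rightarrow> 'a \<times> 'a) \<Rightarrow> nat \<Rightarrow> 'a list \<Rightarrow> 'a list" where
  "apply_at F i w = (case F (w ! (i - 1), w ! i) of (a, b) \<Rightarrow> w[i - 1 := a, i := b])"

definition normalisation :: "'a set \<Rightarrow> ('a list \<Rightarrow> 'a list) \<Rightarrow> bool" where
  "normalisation A N \<longleftrightarrow>
     (\<forall>w\<in>lists A. N w \<in> lists A \<and> length (N w) = length w) \<and>
     (\<forall>s\<in>A. N [s] = [s]) \<and>
     (\<forall>u\<in>lists A. \<forall>v\<in>lists A. \<forall>w\<in>lists A. N (u @ v @ w) = N (u @ N v @ w))"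

definition restr2 :: "('a list \<Rightarrow> 'a list) \<Rightarrow> 'a \<times> 'a \<Rightarrow> 'a \<times> 'a" where
  "restr2 N = (\<lambda>(s, t). (N [s, t] ! 0, N [s, t] ! 1))"

definition quadratic :: "'a set \<Rightarrow> ('a list \<Rightarrow> 'a list) \<Rightarrow> bool" where
  "quadratic A N \<longleftrightarrow>
     (\<forall>w\<in>lists A. N w = w \<longleftrightarrow> (\<forall>u a b v. w = u @ [a, b] @ v \<longrightarrow> N [a, b] = [a, b])) \<and>
     (\<forall>w\<in>lists A. \<exists>is. set is \<subseteq> {1..<length w} \<and> N w = fold (apply_at (restr2 N)) is w)"

definition neutral :: "'a set \<Rightarrow> ('a list \<Rightarrow> 'a list) \<Rightarrow> 'a \<Rightarrow> bool" where
  "neutral A N e \<longleftrightarrow> (\<forall>w\<in>lists A. N (w @ [e]) = N w @ [e] \<and> N ([e] @ w) = N w @ [e])"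

definition normalisation_mod ::
  "('m, 'b) monoid_scheme \<Rightarrow> ('a \<Rightarrow> 'm) \<Rightarrow> 'a set \<Rightarrow> 'a \<Rightarrow> ('a list \<Rightarrow> 'a list) \<Rightarrow> bool" where
  "normalisation_mod M ev S e N \<longleftrightarrow>
     normalisation S N \<and> e \<in> S \<and> neutral S N e \<and>
     presented_by M ev S ({(w, N w) | w. w \<in> lists S} \<union> {([e], [])})"

definition weak_domino :: "'a set \<Rightarrow> 'a \<Rightarrow> ('a \<times> 'a \<Rightarrow> 'a \<times> 'a) \<Rightarrow> bool" where
  "weak_domino S e F \<longleftrightarrow>
     (\<forall>r1\<in>S. \<forall>r2\<in>S. \<forall>r1'\<in>S. \<forall>r2'\<in>S. \<forall>s0\<in>S. \<forall>s1\<in>S. \<forall>s2\<in>S.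
        F (s0, r1) = (r1', s1) \<and> F (s1, r2) = (r2', s2) \<and>
        r1' \<noteq> e \<and> r2' \<noteq> e \<and> s2 \<noteq> e \<and>
        F (r1, r2) = (r1, r2) \<and> F (r1', s1) = (r1', s1) \<and> F (r2', s2) = (r2', s2)
        \<longrightarrow> F (r1', r2') = (r1', r2'))"

definition sweep :: "('a \<times> 'a \<Rightarrow> 'a \<times> 'a) \<Rightarrow> 'a list \<Rightarrow> 'a list" where
  "sweep F w = fold (apply_at F) [1..<length w] w"

lemma length_apply_at [simp]: "length (apply_at F i w) = length w"
  by (simp add: apply_at_def split: prod.split)

lemma length_sweep [simp]: "length (sweep F w) = length w"
proof -
  have "length (fold (apply_at F) is w) = length w" for "is"
    by (induction "is" arbitrary: w) simp_all
  then show ?thesis by (simp add: sweep_def)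
qed

text \<open>\<open>norm_of e \<phi>\<close> is $N_\varphi$ with \<open>e\<close> in the role of 1, and \<open>sweep \<phi>\<close> is $T_\varphi$.
  The recursion ends because \<open>sweep\<close> preserves and $N_\varphi$ does not increase the length.\<close>

function norm_of :: "'a \<Rightarrow> ('a \<times> 'a \<Rightarrow> 'a \<times> 'a) \<Rightarrow> 'a list \<Rightarrow> 'a list" where
  "norm_of e F w =
     (if e \<in> set w then norm_of e F (removeAll e w)
      else case w of
        [] \<Rightarrow> []
      | s # w' \<Rightarrow>
          (let v = sweep F (s # norm_of e F w')
           in if e \<in> set v then norm_of e F v else v))"
  by pat_completeness auto

lemma length_norm_of_dom:
  "norm_of_dom (e, F, w) \<Longrightarrow> length (norm_of e F w) \<le> length w"
proof (induction e F w rule: norm_of.pinduct)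
  case (1 e F w)
  show ?case
  proof (cases "e \<in> set w")
    case True
    then show ?thesis
      using 1 length_removeAll_less_eq[of e w]
      by (subst norm_of.psimps) (auto intro: order_trans)
  next
    case False
    show ?thesis
    proof (cases w)
      case Nil
      then show ?thesis using 1 by (simp add: norm_of.psimps)
    next
      case (Cons s w')
      let ?v = "sweep F (s # norm_of e F w')"
      have "length (norm_of e F w') \<le> length w'"
        using "1.IH"(2) False Cons by blast
      then have v: "length ?v \<le> length w" using Cons by simp
      have "length (norm_of e F ?v) \<le> length ?v" if "e \<in> set ?v"
        using "1.IH"(3) False Cons that by blast
      then show ?thesis
        using v 1(1) False Cons by (auto simp: norm_of.psimps Let_def)
    qed
  qed
qed

termination
proof (relation "measures [\<lambda>(e, F, w). length (removeAll e w), \<lambda>(e, F, w). length w]", goal_cases)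
  case 1
  show ?case by simp
next
  case (2 e F w)
  then show ?case by (simp add: length_removeAll_less)
next
  case (3 e F w s w')
  then show ?case by simp
next
  case (4 e F w s w' v)
  have "length (removeAll e v) < length v"
    using 4 length_removeAll_less[of e v] by blast
  also have "\<dots> \<le> length w"
    using 4 length_norm_of_dom[of e F w'] by simp
  also have "length w = length (removeAll e w)"
    using 4 by simp
  finally show ?case by simp
qed

declare norm_of.simps [simp del]

text \<open>
  In this definition \<open>S\<close> is a subset of \<open>M\<close> containing 1: the injective evaluation \<open>ev\<close>
  identifies the alphabet with its image and \<open>e\<close> with 1. That \<open>S\<close> generates \<open>M\<close> is part of
  the presentation.
\<close>

definition local_factorability_structure ::
  "('m, 'b) monoid_scheme \<Rightarrow> ('a \<Rightarrow> 'm) \<Rightarrow> 'a set \<Rightarrow> 'a \<Rightarrow> ('a \<times> 'a \<Rightarrow> 'a \<times> 'a) \<Rightarrow> bool" where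
  "local_factorability_structure M ev S e \<phi> \<longleftrightarrow>
     e \<in> S \<and> inj_on ev S \<and> ev e = one M \<and>
     (\<forall>p \<in> S \<times> S. \<phi> p \<in> S \<times> S) \<and>
     presented_by M ev (S - {e})
       {([s, t], removeAll e [fst (\<phi> (s, t)), snd (\<phi> (s, t))]) | s t. s \<in> S - {e} \<and> t \<in> S - {e}} \<and>
     (\<forall>p \<in> S \<times> S. \<phi> (\<phi> p) = \<phi> p) \<and>
     (\<forall>s \<in> S - {e}. \<phi> (e, s) = (s, e)) \<and>
     (\<forall>r \<in> S - {e}. \<forall>s \<in> S - {e}. \<forall>t \<in> S - {e}.
        let w = apply_at \<phi> 2 (apply_at \<phi> 1 (apply_at \<phi> 2 [r, s, t]))
        in apply_at \<phi> 1 w = w \<or> e \<in> set w) \<and>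
     (\<forall>r \<in> S. \<forall>s \<in> S. \<forall>t \<in> S.
        norm_of e \<phi> [r, s, t] = norm_of e \<phi> (apply_at \<phi> 1 [r, s, t]))"

end

theory Submission
  imports Defs
begin

text \<open>
  Erasing \<open>e\<close> from \<open>N w\<close> gives a normal form of the class of \<open>w\<close> in \<open>M\<close>: neutrality moves every
  \<open>e\<close> to the end of the word. This separates letters, so the evaluation is injective, and a
  derivation over \<open>S\<close> turns into one over \<open>S - {e}\<close> after erasing \<open>e\<close>, since \<open>N\<close> is a
  composition of two-letter steps. The remaining axioms rest on one fact: if \<open>w\<close> is normal, a sweep
  of \<open>s | w\<close> that produces no \<open>e\<close> is normal, by the weak domino rule. It gives axiom (4) directly
  and shows that $N_\varphi$ is the normal form above, which implies axiom (5).
\<close>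

section \<open>Word congruences\<close>

text \<open>The rule \<open>rel\<close> already admits arbitrary surrounding words, so a further
  context is absorbed there and passes unchanged through symmetry and transitivity.\<close>

lemma word_cong_context:
  assumes "word_cong A R u v" "x \<in> lists A" "y \<in> lists A"
  shows "word_cong A R (x @ u @ y) (x @ v @ y)"
  using assms
proof (induction rule: word_cong.induct)
  case (rel l r u v)
  then show ?case
    using word_cong.rel[of l r R "x @ u" A "v @ y"] by simp
next
  case (refl u)
  then show ?case using word_cong.refl[of "x @ u @ y"] by simp
qed (blast intro: word_cong.sym word_cong.trans)+

lemma word_cong_removeAll:
  assumes "([e], []) \<in> R" "w \<in> lists A"
  shows "word_cong A R w (removeAll e w)"
  using assms(2)
proof (induction w)
  case Nil
  then show ?case by (simp add: word_cong.refl)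
next
  case (Cons a w)
  have a: "word_cong A R (a # w) (a # removeAll e w)"
    using word_cong_context[OF Cons.IH, of "[a]" "[]"] Cons.hyps by simp
  have "removeAll e w \<in> lists A" using Cons.hyps by auto
  then have "word_cong A R (e # removeAll e w) (removeAll e w)"
    using word_cong.rel[OF assms(1), of "[]" A "removeAll e w"] by simp
  with a show ?case by (auto intro: word_cong.trans)
qed

section \<open>Sweeps\<close>

text \<open>Trades positions for factors, so that statements about words in context apply to a
  single step.\<close>

lemma apply_at_split:
  assumes "1 \<le> i" "i < length w"
  obtains u a b v where "w = u @ [a, b] @ v"
    "apply_at F i w = u @ [fst (F (a, b)), snd (F (a, b))] @ v"
proof -
  obtain j where j: "i = Suc j" using assms(1) by (cases i) auto
  have w: "w = take j w @ [w ! j, w ! Suc j] @ drop (Suc (Suc j)) w"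
    using assms(2) j by (simp add: Cons_nth_drop_Suc)
  have "apply_at F i (u @ [a, b] @ v) = u @ [fst (F (a, b)), snd (F (a, b))] @ v"
    if "length u = j" for u a b v
    using that j by (simp add: apply_at_def nth_append list_update_append split: prod.split)
  from this[of "take j w"] w that show ?thesis
    using assms(2) j by (metis Suc_lessD length_take min.absorb4)
qed

text \<open>At \<open>i = 0\<close> the left side would act at position 1 and touch the new head
  \<open>x\<close>.\<close>

lemma apply_at_Suc_Cons:
  "1 \<le> i \<Longrightarrow> apply_at F (Suc i) (x # w) = x # apply_at F i w"
  by (cases i) (auto simp: apply_at_def split: prod.split)

lemma fold_apply_at_Cons:
  "\<forall>i \<in> set is. 1 \<le> i \<Longrightarrow>
    fold (apply_at F) (map Suc is) (x # w) = x # fold (apply_at F) is w"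
  by (induction "is" arbitrary: w) (auto simp: apply_at_Suc_Cons)

lemma sweep_single [simp]: "sweep F [s] = [s]"
  by (simp add: sweep_def)

text \<open>After the step at position 1 the first letter is final, and the remaining positions,
  shifted by one, form a sweep of the rest. This recursion drives the inductions on sweeps.\<close>

lemma sweep_Cons_Cons:
  "sweep F (s # r # w) = fst (F (s, r)) # sweep F (snd (F (s, r)) # w)"
proof -
  have "[1..<length (s # r # w)] = 1 # map Suc [1..<length (snd (F (s, r)) # w)]"
    by (simp only: list.size map_Suc_upt) (simp add: upt_conv_Cons del: upt_Suc)
  moreover have "apply_at F 1 (s # r # w) = fst (F (s, r)) # snd (F (s, r)) # w"
    by (simp add: apply_at_def split: prod.split)
  ultimately show ?thesis
    by (simp add: sweep_def fold_apply_at_Cons del: upt_Suc)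
qed

section \<open>Quadratic normalisations with a neutral letter\<close>

text \<open>Only the combinatorial data are fixed; the monoid, its presentation and the weak domino
  rule enter as premises of single lemmas.\<close>

locale neutral_quadratic_normalisation =
  fixes S :: "'a set" and e :: 'a and N :: "'a list \<Rightarrow> 'a list"
  assumes normalisation: "normalisation S N"
    and quadratic: "quadratic S N"
    and neutral: "neutral S N e"
    and e_in: "e \<in> S"
begin

abbreviation F :: "'a \<times> 'a \<Rightarrow> 'a \<times> 'a" where
  "F \<equiv> restr2 N"

lemma N_in_lists: "w \<in> lists S \<Longrightarrow> N w \<in> lists S"
  and length_N: "w \<in> lists S \<Longrightarrow> length (N w) = length w"
  and N_single: "s \<in> S \<Longrightarrow> N [s] = [s]"
  and N_context:
    "u \<in> lists S \<Longrightarrow> v \<in> lists S \<Longrightarrow> w \<in> lists S \<Longrightarrow> N (u @ N v @ w) = N (u @ v @ w)"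
  using normalisation unfolding normalisation_def by auto

lemma N_idem: "w \<in> lists S \<Longrightarrow> N (N w) = N w"
  using N_context[of "[]" w "[]"] by simp

lemma N_Cons: "s \<in> S \<Longrightarrow> w \<in> lists S \<Longrightarrow> N (s # N w) = N (s # w)"
  using N_context[of "[s]" w "[]"] by simp

lemma N_Nil: "N [] = []"
  using length_N[of "[]"] by simp

lemma N_append_e: "w \<in> lists S \<Longrightarrow> N (w @ [e]) = N w @ [e]"
  and N_e_Cons: "w \<in> lists S \<Longrightarrow> N (e # w) = N w @ [e]"
  using neutral unfolding neutral_def by auto

lemma N_pair:
  assumes "a \<in> S" "b \<in> S"
  shows "N [a, b] = [fst (F (a, b)), snd (F (a, b))]"
proof -
  have "length (N [a, b]) = 2" using assms length_N[of "[a, b]"] by simp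
  then obtain c d where "N [a, b] = [c, d]"
    by (auto simp: numeral_2_eq_2 length_Suc_conv)
  then show ?thesis by (simp add: restr2_def)
qed

lemma F_in:
  assumes "a \<in> S" "b \<in> S"
  shows "fst (F (a, b)) \<in> S" "snd (F (a, b)) \<in> S"
  using N_in_lists[of "[a, b]"] assms by (simp_all add: N_pair)

lemma F_idem: "a \<in> S \<Longrightarrow> b \<in> S \<Longrightarrow> F (F (a, b)) = F (a, b)"
  using N_idem[of "[a, b]"] N_pair[of "fst (F (a, b))" "snd (F (a, b))"]
  by (simp add: N_pair F_in prod_eq_iff)

lemma F_fixed_iff:
  "a \<in> S \<Longrightarrow> b \<in> S \<Longrightarrow> F (a, b) = (a, b) \<longleftrightarrow> N [a, b] = [a, b]"
  by (simp add: N_pair prod_eq_iff)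

lemma F_e_left: "s \<in> S \<Longrightarrow> F (e, s) = (s, e)"
  using N_e_Cons[of "[s]"] by (simp add: restr2_def N_single)

lemma F_e_right: "s \<in> S \<Longrightarrow> F (s, e) = (s, e)"
  using N_append_e[of "[s]"] by (simp add: restr2_def N_single)

section \<open>Erasing the neutral letter\<close>

lemma N_append_replicate:
  "w \<in> lists S \<Longrightarrow> N (w @ replicate k e) = N w @ replicate k e"
proof (induction k)
  case (Suc k)
  have "w @ replicate k e \<in> lists S" using Suc.prems e_in by auto
  from N_append_e[OF this] show ?case
    using Suc by (simp add: replicate_append_same[symmetric])
qed simp

text \<open>Neutrality sends an \<open>e\<close> at the head to the end, and a final block of
  \<open>e\<close> passes through \<open>N\<close>. Induction thus collects all erased letters in
  one final block.\<close>

lemma N_removeAll: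
  "w \<in> lists S \<Longrightarrow> \<exists>k. N w = N (removeAll e w) @ replicate k e"
proof (induction w)
  case (Cons x w)
  then obtain k where k: "N w = N (removeAll e w) @ replicate k e" by auto
  have strip: "removeAll e w \<in> lists S" using Cons.prems by auto
  show ?case
  proof (cases "x = e")
    case True
    then have "N (x # w) = N (removeAll e (x # w)) @ replicate (Suc k) e"
      using k Cons.prems N_e_Cons by (simp add: replicate_append_same)
    then show ?thesis by blast
  next
    case False
    have "N (x # w) = N (x # N (removeAll e w) @ replicate k e)"
      using k Cons.prems N_Cons[of x w] by simp
    also have "\<dots> = N (x # N (removeAll e w)) @ replicate k e"
      using N_append_replicate[of "x # N (removeAll e w)"] Cons.prems N_in_lists[OF strip] by simp
    also have "\<dots> = N (x # removeAll e w) @ replicate k e"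
      using N_Cons[OF _ strip, of x] Cons.prems by simp
    finally show ?thesis using False by auto
  qed
qed simp

lemma removeAll_N_removeAll:
  "w \<in> lists S \<Longrightarrow> removeAll e (N (removeAll e w)) = removeAll e (N w)"
  using N_removeAll[of w] by (auto simp: removeAll_filter_not_eq)

text \<open>Makes \<open>removeAll e (N w)\<close> an invariant of the congruence class, which later
  separates letters.\<close>

lemma removeAll_N_word_cong:
  assumes "word_cong S ({(w, N w) | w. w \<in> lists S} \<union> {([e], [])}) u v"
  shows "removeAll e (N u) = removeAll e (N v)"
  using assms
proof (induction rule: word_cong.induct)
  case (rel l r u v)
  show ?case
  \<comment> \<open>The condition on \<open>r\<close> is needed because \<open>([e], N [e])\<close>
    is also a relation, and belongs to the other case.\<close>
  proof (cases "l = [e] \<and> r = []")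
    case True
    have "removeAll e (u @ l @ v) = removeAll e (u @ r @ v)" using True by simp
    moreover have "u @ l @ v \<in> lists S" "u @ r @ v \<in> lists S"
      using True rel e_in by auto
    ultimately show ?thesis by (metis removeAll_N_removeAll)
  next
    case False
    then have "r = N l" "l \<in> lists S" using rel(1) by auto
    then show ?thesis using rel N_context by simp
  qed
qed auto

section \<open>Invariance of \<open>N\<close> under two-letter steps\<close>

lemma apply_at_invariant:
  assumes "w \<in> lists S" "1 \<le> i" "i < length w"
  shows "apply_at F i w \<in> lists S" "N (apply_at F i w) = N w"
proof -
  obtain u a b v where w: "w = u @ [a, b] @ v"
    and aw: "apply_at F i w = u @ [fst (F (a, b)), snd (F (a, b))] @ v"
    using apply_at_split assms(2,3) .
  have "a \<in> S" "b \<in> S" using w assms(1) by auto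
  then show "apply_at F i w \<in> lists S" "N (apply_at F i w) = N w"
    using w aw assms(1) F_in[of a b] N_context[of u "[a, b]" v] by (auto simp: N_pair)
qed

lemma fold_apply_at_invariant:
  assumes "w \<in> lists S" "set is \<subseteq> {1..<length w}"
  shows "fold (apply_at F) is w \<in> lists S \<and> N (fold (apply_at F) is w) = N w"
  using assms by (induction "is" arbitrary: w) (auto simp: apply_at_invariant)

lemma sweep_in_lists: "w \<in> lists S \<Longrightarrow> sweep F w \<in> lists S"
  and N_sweep: "w \<in> lists S \<Longrightarrow> N (sweep F w) = N w"
  using fold_apply_at_invariant[of w "[1..<length w]"] by (simp_all add: sweep_def)

section \<open>Normality of sweeps\<close>

lemma normal_Cons_Cons:
  assumes "a # b # w \<in> lists S"
  shows "N (a # b # w) = a # b # w \<longleftrightarrow> N [a, b] = [a, b] \<and> N (b # w) = b # w"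
proof -
  have q: "N w = w \<longleftrightarrow> (\<forall>u a b v. w = u @ [a, b] @ v \<longrightarrow> N [a, b] = [a, b])"
    if "w \<in> lists S" for w
    using quadratic that unfolding quadratic_def by blast
  have bw: "b # w \<in> lists S" using assms by simp
  show ?thesis unfolding q[OF assms] q[OF bw]
    by (auto simp: Cons_eq_append_conv) blast+
qed

text \<open>Since \<open>F (e, s) = (s, e)\<close>, a carried \<open>e\<close> travels to the end of
  the word. So a sweep without \<open>e\<close> never carries \<open>e\<close>.\<close>

lemma e_in_sweep: "w \<in> lists S \<Longrightarrow> e \<in> set (sweep F (e # w))"
  by (induction w) (auto simp: sweep_Cons_Cons F_e_left)

text \<open>By quadraticity only adjacent output letters matter, and the weak domino rule handles
  each such pair. The induction leaves \<open>s\<close> arbitrary because the carried letter changes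
  at every step.\<close>

lemma normal_sweep:
  assumes domino: "weak_domino S e F"
    and "w \<in> lists S" "s \<in> S" "N w = w" "e \<notin> set (sweep F (s # w))"
  shows "N (sweep F (s # w)) = sweep F (s # w)"
  using assms(2-)
proof (induction w arbitrary: s)
  case Nil
  then show ?case by (simp add: N_single)
next
  case (Cons r1 w)
  define r1' s1 where r1': "r1' = fst (F (s, r1))" and s1: "s1 = snd (F (s, r1))"
  have F1: "F (s, r1) = (r1', s1)" by (simp add: r1' s1)
  have in1: "r1 \<in> S" "w \<in> lists S" "r1' \<in> S" "s1 \<in> S"
    using Cons.hyps Cons.prems F_in by (auto simp: r1' s1)
  have fix1: "F (r1', s1) = (r1', s1)"
    using F_idem[of s r1] F1 in1 Cons.prems by simp
  have sw: "sweep F (s # r1 # w) = r1' # sweep F (s1 # w)"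
    by (simp add: sweep_Cons_Cons F1)
  \<comment> \<open>\<open>hd w\<close> and \<open>tl w\<close> let the recursion for normality
    apply when \<open>w\<close> is nonempty.\<close>
  have "N w = w"
    using Cons.prems(2) in1 normal_Cons_Cons[of r1 "hd w" "tl w"]
    by (cases "w = []") (simp_all add: N_Nil)
  then have IH: "N (sweep F (s1 # w)) = sweep F (s1 # w)"
    using Cons.IH[of s1] Cons.prems in1 sw by simp
  show ?case
  proof (cases w)
    case Nil
    then show ?thesis using fix1 F_fixed_iff in1 sw by simp
  next
    case (Cons r2 w')
    define r2' s2 where r2': "r2' = fst (F (s1, r2))" and s2: "s2 = snd (F (s1, r2))"
    have F2: "F (s1, r2) = (r2', s2)" by (simp add: r2' s2)
    have in2: "r2 \<in> S" "w' \<in> lists S" "r2' \<in> S" "s2 \<in> S"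
      using in1 Cons F_in by (auto simp: r2' s2)
    have fix2: "F (r2', s2) = (r2', s2)"
      using F_idem[of s1 r2] F2 in1 in2 by simp
    have sw2: "sweep F (s1 # w) = r2' # sweep F (s2 # w')"
      by (simp add: Cons sweep_Cons_Cons F2)
    \<comment> \<open>The first two are output letters. The letter \<open>s2\<close> need not be
      one, but if it were \<open>e\<close> then an \<open>e\<close> would reach the output.\<close>
    have "r1' \<noteq> e" "r2' \<noteq> e" "s2 \<noteq> e"
      using Cons.prems(3) sw sw2 e_in_sweep[OF in2(2)] by auto
    moreover have "F (r1, r2) = (r1, r2)"
      using Cons.prems(2) Cons in1 in2 normal_Cons_Cons[of r1 r2 w'] F_fixed_iff by simp
    ultimately have "F (r1', r2') = (r1', r2')"
      using domino F1 F2 fix1 fix2 in1 in2 Cons.prems(1) unfolding weak_domino_def by blast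
    then show ?thesis
      using IH normal_Cons_Cons[of r1' r2' "sweep F (s2 # w')"] sweep_in_lists[of "s2 # w'"]
        in1 in2 F_fixed_iff sw sw2 by simp
  qed
qed

text \<open>Erasing may create new neighbours, so the argument is by length: \<open>N ?u\<close> is
  as long as \<open>?u\<close> and becomes \<open>?u\<close> after erasing, hence contains no
  \<open>e\<close>.\<close>

lemma removeAll_normal:
  assumes "w \<in> lists S" "N w = w"
  shows "N (removeAll e w) = removeAll e w"
proof -
  let ?u = "removeAll e w"
  have u: "?u \<in> lists S" using assms(1) by auto
  have strip: "removeAll e (N ?u) = ?u"
    using removeAll_N_removeAll assms by simp
  then have "length (removeAll e (N ?u)) = length (N ?u)"
    using length_N[OF u] by simp
  then have "e \<notin> set (N ?u)"
    using length_removeAll_less[of e "N ?u"] by auto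
  then show ?thesis using strip by simp
qed

text \<open>Every step of the recursion preserves \<open>removeAll e (N w)\<close>; when it stops at
  a sweep without \<open>e\<close>, that sweep is normal and equals this value.\<close>

lemma norm_of_eq_removeAll_N:
  assumes domino: "weak_domino S e F" and "w \<in> lists S"
  shows "norm_of e F w = removeAll e (N w)"
proof -
  \<comment> \<open>The induction rule of \<open>norm_of\<close> varies all three arguments, so the
    two fixed ones are generalised and tied back by equations.\<close>
  have "norm_of e' F' w = removeAll e (N w)" if "e' = e" "F' = F" "w \<in> lists S" for e' F' w
    using that
  proof (induction e' F' w rule: norm_of.induct)
    case (1 e' F' w)
    note eqs = "1.prems"(1,2)
    note IH = "1.IH"[unfolded eqs]
    have "norm_of e F w = removeAll e (N w)"
    proof (cases "e \<in> set w")
      case True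
      have "removeAll e w \<in> lists S" using "1.prems"(3) by auto
      then have "norm_of e F (removeAll e w) = removeAll e (N w)"
        using IH(1)[OF True] True removeAll_N_removeAll "1.prems"(3) by simp
      then show ?thesis using True by (simp add: norm_of.simps[of e F w])
    next
      case False
      show ?thesis
      proof (cases w)
        case Nil
        then show ?thesis by (simp add: norm_of.simps N_Nil)
      next
        case (Cons s w')
        have w': "s \<in> S" "w' \<in> lists S" "s \<noteq> e" using "1.prems"(3) Cons False by auto
        define u where "u = removeAll e (N w')"
        have IH_tail: "norm_of e F w' = u"
          using IH(2)[OF False Cons] w' by (simp add: u_def)
        have u: "u \<in> lists S" "N u = u"
          using N_in_lists[OF w'(2)] N_idem[OF w'(2)] removeAll_normal[of "N w'"]
          by (auto simp: u_def)
        define v where "v = sweep F (s # u)"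
        have v: "v \<in> lists S" using sweep_in_lists[of "s # u"] u w' by (simp add: v_def)
        \<comment> \<open>Undoes in turn the sweep, the erasure in the tail and the normalisation of
          the tail.\<close>
        have "removeAll e (N v) = removeAll e (N (s # u))"
          using N_sweep u w' by (simp add: v_def)
        also have "\<dots> = removeAll e (N (s # N w'))"
          using removeAll_N_removeAll[of "s # N w'"] w' N_in_lists by (simp add: u_def)
        finally have N_v: "removeAll e (N v) = removeAll e (N w)"
          using N_Cons w' Cons by simp
        have step: "norm_of e F w = (if e \<in> set v then norm_of e F v else v)"
          using False Cons IH_tail by (subst norm_of.simps) (simp add: v_def Let_def)
        show ?thesis
        proof (cases "e \<in> set v")
          case True
          then show ?thesis
            using IH(3)[OF False Cons, of v] IH_tail v N_v step by (simp add: v_def)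
        next
          case False
          then have "N v = v"
            using normal_sweep[OF domino u(1) w'(1) u(2)] by (simp add: v_def)
          then show ?thesis using False N_v step by simp
        qed
      qed
    qed
    then show ?case by (simp only: eqs)
  qed
  from this[OF HOL.refl HOL.refl assms(2)] show ?thesis .
qed

section \<open>The presentation over \<open>S - {e}\<close>\<close>

definition reduced_relations :: "('a list \<times> 'a list) set" where
  "reduced_relations =
    {([s, t], removeAll e [fst (F (s, t)), snd (F (s, t))]) | s t. s \<in> S - {e} \<and> t \<in> S - {e}}"

text \<open>A step on two letters other than \<open>e\<close> is a defining relation after erasing;
  a step on a pair containing \<open>e\<close> only moves \<open>e\<close>, so it becomes
  trivial.\<close>

lemma apply_at_reduced_word_cong:
  assumes "w \<in> lists S" "1 \<le> i" "i < length w"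
  shows "word_cong (S - {e}) reduced_relations (removeAll e w) (removeAll e (apply_at F i w))"
proof -
  obtain u a b v where w: "w = u @ [a, b] @ v"
    and aw: "apply_at F i w = u @ [fst (F (a, b)), snd (F (a, b))] @ v"
    using apply_at_split assms(2,3) .
  have in_S: "a \<in> S" "b \<in> S" using w assms(1) by auto
  have uv: "removeAll e u \<in> lists (S - {e})" "removeAll e v \<in> lists (S - {e})"
    using w assms(1) by auto
  have "word_cong (S - {e}) reduced_relations (removeAll e [a, b])
      (removeAll e [fst (F (a, b)), snd (F (a, b))])"
  proof (cases "a = e \<or> b = e")
    case True
    then have "removeAll e [fst (F (a, b)), snd (F (a, b))] = removeAll e [a, b]"
      using F_e_left[OF in_S(2)] F_e_right[OF in_S(1)] by (elim disjE) simp_all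
    moreover have "removeAll e [a, b] \<in> lists (S - {e})" using in_S by auto
    ultimately show ?thesis by (simp only: word_cong.refl)
  next
    case False
    then have "([a, b], removeAll e [fst (F (a, b)), snd (F (a, b))]) \<in> reduced_relations"
      using in_S unfolding reduced_relations_def by blast
    from word_cong.rel[OF this lists.Nil lists.Nil] have
      "word_cong (S - {e}) reduced_relations [a, b]
        (removeAll e [fst (F (a, b)), snd (F (a, b))])"
      by (simp only: append_Nil append_Nil2)
    moreover have "removeAll e [a, b] = [a, b]" using False by auto
    ultimately show ?thesis by (simp only:)
  qed
  from word_cong_context[OF this uv] show ?thesis
    unfolding aw unfolding w removeAll_append .
qed

lemma fold_apply_at_reduced_word_cong:
  assumes "w \<in> lists S" "set is \<subseteq> {1..<length w}"
  shows "word_cong (S - {e}) reduced_relations (removeAll e w)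
    (removeAll e (fold (apply_at F) is w))"
  using assms
proof (induction "is" arbitrary: w)
  case Nil
  then have "removeAll e w \<in> lists (S - {e})" by auto
  then show ?case by (simp add: word_cong.refl)
next
  case (Cons i "is")
  then have i: "1 \<le> i" "i < length w" by auto
  have "word_cong (S - {e}) reduced_relations (removeAll e (apply_at F i w))
      (removeAll e (fold (apply_at F) is (apply_at F i w)))"
    using Cons.prems Cons.IH[of "apply_at F i w"] apply_at_invariant(1)[OF Cons.prems(1) i]
    by simp
  then show ?case
    using word_cong.trans[OF apply_at_reduced_word_cong[OF Cons.prems(1) i]] by simp
qed

text \<open>Quadraticity writes \<open>N\<close> as a composition of two-letter steps, each of which
  is derivable after erasing.\<close>

lemma reduced_word_cong_N:
  assumes "w \<in> lists S"
  shows "word_cong (S - {e}) reduced_relations (removeAll e w) (removeAll e (N w))"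
proof -
  obtain "is" where "set is \<subseteq> {1..<length w}" "N w = fold (apply_at F) is w"
    using quadratic assms unfolding quadratic_def by blast
  then show ?thesis using fold_apply_at_reduced_word_cong assms by metis
qed

lemma reduced_word_cong_removeAll:
  assumes "word_cong S ({(w, N w) | w. w \<in> lists S} \<union> {([e], [])}) u v"
  shows "word_cong (S - {e}) reduced_relations (removeAll e u) (removeAll e v)"
  using assms
proof (induction rule: word_cong.induct)
  case (rel l r u v)
  then have uv: "removeAll e u \<in> lists (S - {e})" "removeAll e v \<in> lists (S - {e})"
    by auto
  have "word_cong (S - {e}) reduced_relations (removeAll e l) (removeAll e r)"
  \<comment> \<open>Here \<open>r\<close> is \<open>[]\<close> or \<open>N [e] = [e]\<close>, and
    both sides erase to the empty word.\<close>
  proof (cases "l = [e]")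
    case True
    then have "removeAll e l = []" "removeAll e r = []"
      using rel(1) N_single e_in by auto
    then show ?thesis by (simp add: word_cong.refl)
  next
    case False
    then have "r = N l" "l \<in> lists S" using rel(1) by auto
    then show ?thesis using reduced_word_cong_N by simp
  qed
  from word_cong_context[OF this uv] show ?case by simp
next
  case (refl u)
  then have "removeAll e u \<in> lists (S - {e})" by auto
  then show ?case by (rule word_cong.refl)
qed (auto intro: word_cong.sym word_cong.trans)

text \<open>A reduced relation is a relation \<open>([s, t], N [s, t])\<close> followed by deletions
  of \<open>e\<close>.\<close>

lemma word_cong_of_reduced:
  assumes "word_cong (S - {e}) reduced_relations u v"
  shows "word_cong S ({(w, N w) | w. w \<in> lists S} \<union> {([e], [])}) u v" (is "word_cong S ?R u v")
  using assms
proof (induction rule: word_cong.induct)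
  case (rel l r u v)
  then obtain s t where l: "l = [s, t]" and st: "s \<in> S" "t \<in> S"
    and r: "r = removeAll e (N [s, t])"
    by (auto simp: N_pair reduced_relations_def)
  have w: "[s, t] \<in> lists S" using st by simp
  have "word_cong S ?R ([] @ [s, t] @ []) ([] @ N [s, t] @ [])"
    by (rule word_cong.rel) (use st in auto)
  moreover have "word_cong S ?R (N [s, t]) r"
    unfolding r by (rule word_cong_removeAll) (use N_in_lists[OF w] in auto)
  ultimately have "word_cong S ?R l r"
    unfolding l by (auto intro: word_cong.trans)
  then show ?case by (rule word_cong_context) (use rel in auto)
next
  case (refl u)
  then have "u \<in> lists S" by auto
  then show ?case by (rule word_cong.refl)
qed (blast intro: word_cong.sym word_cong.trans)+

text \<open>Erasing preserves evaluation, so the smaller alphabet still reaches all of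
  \<open>M\<close>. It fixes words over \<open>S - {e}\<close>, so derivations over the two
  alphabets correspond.\<close>

lemma presented_by_reduced:
  assumes P: "presented_by M ev S ({(w, N w) | w. w \<in> lists S} \<union> {([e], [])})"
  shows "presented_by M ev (S - {e}) reduced_relations"
proof -
  let ?R = "{(w, N w) | w. w \<in> lists S} \<union> {([e], [])}"
  have iff: "eval_word M ev u = eval_word M ev v \<longleftrightarrow> word_cong S ?R u v"
    if "u \<in> lists S" "v \<in> lists S" for u v
    using P that unfolding presented_by_def by blast
  have sub: "u \<in> lists S" if "u \<in> lists (S - {e})" for u using that by auto
  have strip: "removeAll e u = u" if "u \<in> lists (S - {e})" for u
    using that by (induction u) auto
  have "eval_word M ev w = eval_word M ev (removeAll e w)" if "w \<in> lists S" for w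
  proof -
    have "removeAll e w \<in> lists S" using that by auto
    then show ?thesis using iff[OF that] word_cong_removeAll[OF _ that, of e ?R] by simp
  qed
  moreover have "removeAll e w \<in> lists (S - {e})" if "w \<in> lists S" for w using that by auto
  ultimately have "eval_word M ev ` lists S \<subseteq> eval_word M ev ` lists (S - {e})" by blast
  then have "eval_word M ev ` lists (S - {e}) = eval_word M ev ` lists S"
    using sub by blast
  then have "eval_word M ev ` lists (S - {e}) = carrier M"
    using P by (simp add: presented_by_def)
  moreover have "ev ` (S - {e}) \<subseteq> carrier M"
    using P unfolding presented_by_def by blast
  moreover have "eval_word M ev u = eval_word M ev v \<longleftrightarrow>
      word_cong (S - {e}) reduced_relations u v"
    if "u \<in> lists (S - {e})" "v \<in> lists (S - {e})" for u v
    using iff[OF sub sub, OF that] word_cong_of_reduced[of u v]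
      reduced_word_cong_removeAll[of u v] strip[OF that(1)] strip[OF that(2)] by auto
  moreover have "reduced_relations \<subseteq> lists (S - {e}) \<times> lists (S - {e})"
    using F_in by (auto simp: reduced_relations_def)
  ultimately show ?thesis
    unfolding presented_by_def by (intro conjI ballI)
qed

section \<open>Letters as elements of \<open>M\<close>\<close>

lemma inj_on_ev:
  assumes "presented_by M ev S ({(w, N w) | w. w \<in> lists S} \<union> {([e], [])})"
  shows "inj_on ev S"
proof (rule inj_onI)
  fix s t assume st: "s \<in> S" "t \<in> S" and "ev s = ev t"
  then have "eval_word M ev [s] = eval_word M ev [t]" by (simp add: eval_word_def)
  moreover have "[s] \<in> lists S" "[t] \<in> lists S" using st by auto
  ultimately have "word_cong S ({(w, N w) | w. w \<in> lists S} \<union> {([e], [])}) [s] [t]"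
    using assms unfolding presented_by_def by blast
  \<comment> \<open>The invariant of \<open>[s]\<close> is \<open>[]\<close> if \<open>s = e\<close>
    and \<open>[s]\<close> otherwise, so it determines \<open>s\<close>.\<close>
  from removeAll_N_word_cong[OF this] show "s = t"
    using st by (auto simp: N_single split: if_splits)
qed

lemma ev_e:
  assumes "monoid M" "presented_by M ev S ({(w, N w) | w. w \<in> lists S} \<union> {([e], [])})"
  shows "ev e = one M"
proof -
  let ?R = "{(w, N w) | w. w \<in> lists S} \<union> {([e], [])}"
  have "word_cong S ?R [e] []"
    using word_cong_removeAll[of e ?R "[e]" S] e_in by simp
  moreover have "[e] \<in> lists S" using e_in by simp
  ultimately have "eval_word M ev [e] = eval_word M ev []"
    using assms(2) unfolding presented_by_def by blast
  moreover have "ev e \<in> carrier M" using assms(2) e_in unfolding presented_by_def by blast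
  ultimately show ?thesis using assms(1) by (simp add: eval_word_def monoid.r_one)
qed

text \<open>The first step makes the last two letters normal; the next two steps are a sweep of the
  three-letter word. Without \<open>e\<close> its result is normal, so a further step at position 1
  changes nothing.\<close>

lemma braid_or_e:
  assumes domino: "weak_domino S e F" and "r \<in> S" "s \<in> S" "t \<in> S"
  shows "let w = apply_at F 2 (apply_at F 1 (apply_at F 2 [r, s, t]))
    in apply_at F 1 w = w \<or> e \<in> set w"
proof -
  obtain r1 r2 where F1: "F (s, t) = (r1, r2)" by fastforce
  have in1: "r1 \<in> S" "r2 \<in> S" using F_in[of s t] F1 assms by simp_all
  have fix1: "N [r1, r2] = [r1, r2]"
    using F_idem[of s t] F1 assms F_fixed_iff in1 by simp
  obtain a b c where abc: "sweep F [r, r1, r2] = [a, b, c]"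
    by (simp add: sweep_Cons_Cons)
  have "apply_at F 2 [r, s, t] = [r, r1, r2]"
    by (simp add: apply_at_def F1)
  then have w: "apply_at F 2 (apply_at F 1 (apply_at F 2 [r, s, t])) = [a, b, c]"
    using abc by (simp add: sweep_def upt_rec numeral_2_eq_2)
  have "apply_at F 1 [a, b, c] = [a, b, c]" if "e \<notin> {a, b, c}"
  proof -
    have "N [a, b, c] = [a, b, c]"
      using normal_sweep[OF domino, of "[r1, r2]" r] fix1 in1 assms abc that by simp
    moreover have "[a, b, c] \<in> lists S"
      using sweep_in_lists[of "[r, r1, r2]"] abc in1 assms by simp
    ultimately have "F (a, b) = (a, b)"
      using normal_Cons_Cons[of a b "[c]"] F_fixed_iff by simp
    then show ?thesis by (simp add: apply_at_def)
  qed
  then show ?thesis unfolding w Let_def by auto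
qed

end

section \<open>Local factorability\<close>

theorem proposition4p1p11:
  fixes M :: "('m, 'b) monoid_scheme"
    and ev :: "'a \<Rightarrow> 'm"
    and S :: "'a set"
    and e :: 'a
    and N :: "'a list \<Rightarrow> 'a list"
  assumes "monoid M"
    and "normalisation_mod M ev S e N"
    and "quadratic S N"
    and "weak_domino S e (restr2 N)"
  shows "local_factorability_structure M ev S e (restr2 N)"
proof -
  interpret neutral_quadratic_normalisation S e N
    using assms(2,3) by unfold_locales (auto simp: normalisation_mod_def)
  have P: "presented_by M ev S ({(w, N w) | w. w \<in> lists S} \<union> {([e], [])})"
    using assms(2) by (simp add: normalisation_mod_def)
  \<comment> \<open>Both sides are erased values of \<open>N\<close>, which a two-letter step does
    not change.\<close>
  have "norm_of e F [r, s, t] = norm_of e F (apply_at F 1 [r, s, t])"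
    if "r \<in> S" "s \<in> S" "t \<in> S" for r s t
    using norm_of_eq_removeAll_N[OF assms(4)] apply_at_invariant[of "[r, s, t]" 1] that by simp
  moreover have "\<forall>p \<in> S \<times> S. F p \<in> S \<times> S" "\<forall>p \<in> S \<times> S. F (F p) = F p"
    using F_in F_idem by (auto simp: mem_Times_iff)
  ultimately show ?thesis
    unfolding local_factorability_structure_def
    using e_in inj_on_ev[OF P] ev_e[OF assms(1) P] F_e_left braid_or_e[OF assms(4)]
      presented_by_reduced[OF P, unfolded reduced_relations_def]
    by (intro conjI) blast+
qed

end
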